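(* Let $M \in \mathrm{Sp}(2n;\mathbb{R})$ be diagonalizable (over $\mathbb{C}$) with mutually distinct eigenvalues, all on the unit circle, and let $V \in \mathrm{Sp}(2n;\mathbb{R})$ be a linear normal form map for $M$. Let $G \in \mathbb{R}^{2n\times 2n}$ be symmetric positive definite with $M G M^{tr} = G$. Write $G = V\,\mathrm{diag}(\Lambda,\Lambda)\,V^{tr}$ with $\Lambda = \mathrm{diag}(\epsilon_1,\dots,\epsilon_n)$, so that $\epsilon_1,\dots,\epsilon_n$ are the emittances of $G$. Then the emittances are given by the symplectic spectrum of $G$: whenever $S \in \mathrm{Sp}(2n;\mathbb{R})$ and $\Lambda' = \mathrm{diag}(\lambda_1,\dots,\lambda_n)$ satisfy $G = S^{tr}\,\mathrm{diag}(\Lambda',\Lambda')\,S$, the tuples $(\lambda_1,\dots,\lambda_n)$ and $(\epsilon_1,\dots,\epsilon_n)$ agree up to a permutation.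
   Context: $J = \begin{pmatrix} 0 & 1_n \\ -1_n & 0\end{pmatrix}$, and $\mathrm{Sp}(2n;\mathbb{R})$ is the group of real $2n \times 2n$ matrices $S$ with $S^{tr} J S = J$. A linear normal form map for $M$ is a matrix $V \in \mathrm{Sp}(2n;\mathbb{R})$ such that $V^{-1} M V$ leaves every plane $\mathrm{span}\{e_k, e_{n+k}\}$, $k=1,\dots,n$, invariant and acts on it, in the basis $(e_k,e_{n+k})$, by a rotation matrix $\begin{pmatrix} \cos\varphi_k & \sin\varphi_k \\ -\sin\varphi_k & \cos\varphi_k\end{pmatrix}$, $\varphi_k\in[0,2\pi)$; it exists for every $M$ as in the claim. For such $M$ and $V$, a real symmetric $G$ satisfies $MGM^{tr}=G$ if and only if $G = V\,\mathrm{diag}(\Lambda,\Lambda)\,V^{tr}$ for some real diagonal $n \times n$ matrix $\Lambda$; the diagonal entries of $\Lambda$ are called the emittances of $G$. By Williamson's theorem every real symmetric positive definite $G$ can be written $G = S^{tr}\,\mathrm{diag}(\Lambda',\Lambda')\,S$ with $S$ symplectic and $\Lambda'$ diagonal; the diagonal entries of $\Lambda'$ form the symplectic spectrum of $G$. A covariance matrix $G$ is called linearly matched (with respect to the one-turn map $M$) if $MGM^{tr}=G$. *)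

theory Defs
  imports
    "Jordan_Normal_Form.Spectral_Radius"
    "HOL-Combinatorics.Permutations"
begin

(* Indices are 0-based: the basis vectors written e_k and e_{n+k} (k = 1..n) on paper
   are unit_vec (2*n) k and unit_vec (2*n) (n+k) for k < n. *)

definition symplectic_J :: "nat \<Rightarrow> real mat" where
  "symplectic_J n = four_block_mat (0\<^sub>m n n) (1\<^sub>m n) (- 1\<^sub>m n) (0\<^sub>m n n)"

definition Sp :: "nat \<Rightarrow> real mat set" where
  "Sp n = {S \<in> carrier_mat (2*n) (2*n). transpose_mat S * symplectic_J n * S = symplectic_J n}"

definition double_diag :: "nat \<Rightarrow> (nat \<Rightarrow> real) \<Rightarrow> real mat" where
  "double_diag n l = four_block_mat (mat_diag n l) (0\<^sub>m n n) (0\<^sub>m n n) (mat_diag n l)"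

definition diagonalizable :: "'a :: field mat \<Rightarrow> bool" where
  "diagonalizable A \<longleftrightarrow> (\<exists>D. diagonal_mat D \<and> similar_mat A D)"

(* W is the inverse of V. The columns of the rotation matrix give the images of e_k and
   e_{n+k}; the two equations include the invariance of span {e_k, e_{n+k}}. *)
definition linear_normal_form_map :: "nat \<Rightarrow> real mat \<Rightarrow> real mat \<Rightarrow> bool" where
  "linear_normal_form_map n M V \<longleftrightarrow> V \<in> Sp n \<and>
    (\<exists>W \<in> carrier_mat (2*n) (2*n). inverts_mat V W \<and> inverts_mat W V \<and>
      (\<forall>k<n. \<exists>\<phi>. 0 \<le> \<phi> \<and> \<phi> < 2 * pi \<and>
        (W * M * V) *\<^sub>v unit_vec (2*n) k =
          cos \<phi> \<cdot>\<^sub>v unit_vec (2*n) k + (- sin \<phi>) \<cdot>\<^sub>v unit_vec (2*n) (n+k) \<and>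
        (W * M * V) *\<^sub>v unit_vec (2*n) (n+k) =
          sin \<phi> \<cdot>\<^sub>v unit_vec (2*n) k + cos \<phi> \<cdot>\<^sub>v unit_vec (2*n) (n+k)))"

definition sym_pos_def :: "nat \<Rightarrow> real mat \<Rightarrow> bool" where
  "sym_pos_def m G \<longleftrightarrow> G \<in> carrier_mat m m \<and> transpose_mat G = G \<and>
    (\<forall>v \<in> carrier_vec m. v \<noteq> 0\<^sub>v m \<longrightarrow> 0 < v \<bullet> (G *\<^sub>v v))"

definition linearly_matched :: "real mat \<Rightarrow> real mat \<Rightarrow> bool" where
  "linearly_matched M G \<longleftrightarrow> M * G * transpose_mat M = G"

end

(* G and J determine the matrix J G, and for every symplectic factorization G = P D P^T it is
   similar to J D, so the spectrum of (J G)^2 consists of the negated squares of the diagonal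
   entries, each taken twice. Positive definiteness makes the entries positive, hence the squares
   determine them. The emittances and the symplectic spectrum arise from two such factorizations,
   with P = V and P = S^T. *)
theory Submission
  imports Defs
begin

text \<open>Reads the eigenvalues, with multiplicities, off a characteristic polynomial that is
  split into linear factors.\<close>

lemma proots_prod_list_linear:
  "proots (\<Prod>a\<leftarrow>as. [:- a, 1:]) = mset (as :: 'a :: idom list)"
proof (induction as)
  case (Cons a as)
  have "(\<Prod>a\<leftarrow>as. [:- a, 1:]) \<noteq> 0"
    by (auto simp: prod_list_zero_iff)
  then show ?case
    using Cons by (simp add: proots_mult del: mult_pCons_left)
qed simp

text \<open>With all dimensions equal, the inner one is fixed by the goal, so the simplifier can
  apply the rule.\<close>

lemmas square_mult_carrier = mult_carrier_mat[of _ n n _ n for n]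

lemma symplectic_J_carrier [simp]: "symplectic_J n \<in> carrier_mat (2*n) (2*n)"
  by (simp add: symplectic_J_def mult_2)

lemma double_diag_carrier [simp]: "double_diag n l \<in> carrier_mat (2*n) (2*n)"
  by (simp add: double_diag_def mult_2)

lemma symplectic_J_dim [simp]:
  "dim_row (symplectic_J n) = 2*n" "dim_col (symplectic_J n) = 2*n"
  using symplectic_J_carrier[of n] by (auto simp del: symplectic_J_carrier)

lemma mat_diag_dim_row_col [simp]:
  "dim_row (mat_diag n l) = n" "dim_col (mat_diag n l) = n"
  by (simp_all add: mat_diag_def)

lemma Sp_dim:
  assumes "P \<in> Sp n"
  shows "P \<in> carrier_mat (2*n) (2*n)" "dim_row P = 2*n" "dim_col P = 2*n"
  using assms by (auto simp: Sp_def)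

lemma symplectic_J_square: "symplectic_J n * symplectic_J n = - 1\<^sub>m (2*n)"
proof -
  have "symplectic_J n * symplectic_J n =
      four_block_mat (- 1\<^sub>m n) (0\<^sub>m n n) (0\<^sub>m n n) (- 1\<^sub>m n)"
    unfolding symplectic_J_def
    by (subst mult_four_block_mat[of _ n n _ n _ n _ _ n _ n]) (auto simp: mult_2)
  also have "\<dots> = - 1\<^sub>m (2*n)"
    by (rule eq_matI) auto
  finally show ?thesis .
qed

text \<open>The product of \<open>symplectic_J n\<close> and \<open>double_diag n l\<close> is block
  antidiagonal with eigenvalues \<open>+-i * l k\<close>; squaring makes it diagonal and keeps the
  spectrum real.\<close>

lemma symplectic_J_double_diag_square:
  "(symplectic_J n * double_diag n l) * (symplectic_J n * double_diag n l) =
    double_diag n (\<lambda>i. - (l i)\<^sup>2)"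
proof -
  have JD: "symplectic_J n * double_diag n l =
      four_block_mat (0\<^sub>m n n) (mat_diag n l) (- mat_diag n l) (0\<^sub>m n n)"
    unfolding symplectic_J_def double_diag_def
    by (subst mult_four_block_mat[of _ n n _ n _ n _ _ n _ n])
      (auto simp: left_mult_one_mat[OF mat_diag_dim] left_mult_zero_mat[OF mat_diag_dim])
  have "- mat_diag n (\<lambda>i. l i * l i) = mat_diag n (\<lambda>i. - (l i)\<^sup>2)"
    by (rule eq_matI) (auto simp: mat_diag_def power2_eq_square)
  then show ?thesis
    unfolding JD double_diag_def[of n "\<lambda>i. - (l i)\<^sup>2"]
    by (subst mult_four_block_mat[of _ n n _ n _ n _ _ n _ n])
      (auto simp: left_mult_zero_mat[OF mat_diag_dim] right_mult_zero_mat[OF mat_diag_dim])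
qed

lemma proots_char_poly_double_diag:
  "proots (char_poly (double_diag n l)) = mset (map l [0..<n]) + mset (map l [0..<n])"
proof -
  have "upper_triangular (double_diag n l)"
    by (auto simp: double_diag_def mat_diag_def upper_triangular_def)
  then have "proots (char_poly (double_diag n l)) = mset (diag_mat (double_diag n l))"
    by (simp add: char_poly_upper_triangular[OF double_diag_carrier] proots_prod_list_linear)
  also have "diag_mat (double_diag n l) = map l [0..<n] @ map l [0..<n]"
    unfolding double_diag_def
    by (subst diag_four_block_mat[of _ n _ n]) (auto simp: diag_mat_def mat_diag_def)
  finally show ?thesis
    by simp
qed

text \<open>Since \<open>J * J = -1\<close>, multiplying \<open>P^T * J * P = J\<close> by
  \<open>-J\<close> from the left exhibits a left inverse of \<open>P\<close>, which for square
  matrices is also a right inverse.\<close>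

lemma Sp_inverse:
  assumes "P \<in> Sp n"
  shows "P * (- (symplectic_J n * transpose_mat P * symplectic_J n)) = 1\<^sub>m (2*n)"
proof -
  note P = Sp_dim[OF assms]
  have eq: "transpose_mat P * symplectic_J n * P = symplectic_J n"
    using assms by (simp add: Sp_def)
  let ?J = "symplectic_J n"
  let ?Q = "- (?J * transpose_mat P * ?J)"
  have Q: "?Q \<in> carrier_mat (2*n) (2*n)"
    using P by (simp add: square_mult_carrier)
  have "?J * transpose_mat P * ?J * P = ?J * (transpose_mat P * ?J * P)"
    using P by (simp add: assoc_mult_mat[of _ "2*n" "2*n" _ "2*n" _ "2*n"]
        square_mult_carrier[of _ "2*n"])
  then have "?Q * P = 1\<^sub>m (2*n)"
    using P eq by (simp add: symplectic_J_square)
  then show ?thesis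
    using mat_mult_left_right_inverse[OF Q P(1)] by simp
qed

lemma Sp_transpose:
  assumes "P \<in> Sp n"
  shows "transpose_mat P \<in> Sp n"
proof -
  note P = Sp_dim[OF assms]
  let ?J = "symplectic_J n"
  \<comment> \<open>The identity is inserted as \<open>-(J * J)\<close>, so that regrouping produces
    \<open>P\<close> times the inverse from \<open>Sp_inverse\<close>.\<close>
  have "(P * ?J * transpose_mat P) = - (P * ?J * transpose_mat P * (?J * ?J))"
    using P by (simp add: symplectic_J_square)
  also have "\<dots> = (P * (- (?J * transpose_mat P * ?J))) * ?J"
    using P by (simp add: assoc_mult_mat[of _ "2*n" "2*n" _ "2*n" _ "2*n"]
        square_mult_carrier[of _ "2*n"])
  also have "\<dots> = ?J"
    by (simp add: Sp_inverse[OF assms])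
  finally show ?thesis
    using P by (simp add: Sp_def)
qed

lemma Sp_transpose_inverse:
  assumes "P \<in> Sp n"
  defines "R \<equiv> - (symplectic_J n * P * symplectic_J n)"
  shows "R \<in> carrier_mat (2*n) (2*n)" "transpose_mat P * R = 1\<^sub>m (2*n)"
    "R * transpose_mat P = 1\<^sub>m (2*n)"
proof -
  note P = Sp_dim[OF Sp_transpose[OF assms(1)]]
  show R: "R \<in> carrier_mat (2*n) (2*n)"
    using P by (simp add: R_def square_mult_carrier)
  show "transpose_mat P * R = 1\<^sub>m (2*n)"
    using Sp_inverse[OF Sp_transpose[OF assms(1)]] by (simp add: R_def)
  then show "R * transpose_mat P = 1\<^sub>m (2*n)"
    by (rule mat_mult_left_right_inverse[OF P(1) R])
qed

text \<open>Multiplication by \<open>J\<close> turns the congruence by \<open>P\<close> into a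
  similarity: the inverse \<open>R = -(J * P * J)\<close> of \<open>P^T\<close> satisfies
  \<open>R * J = J * P\<close>, hence \<open>J * P * D * P^T = R * (J * D) * P^T\<close>.\<close>

lemma similar_symplectic_J_mult:
  assumes "P \<in> Sp n" and D: "D \<in> carrier_mat (2*n) (2*n)"
  shows "similar_mat_wit (symplectic_J n * (P * D * transpose_mat P)) (symplectic_J n * D)
    (- (symplectic_J n * P * symplectic_J n)) (transpose_mat P)"
proof (rule similar_mat_witI)
  let ?J = "symplectic_J n" and ?R = "- (symplectic_J n * P * symplectic_J n)"
  note P = Sp_dim[OF assms(1)]
  have "?R * ?J = - (?J * P * (?J * ?J))"
    using P by (simp add: assoc_mult_mat[of _ "2*n" "2*n" _ "2*n" _ "2*n"]
        square_mult_carrier[of _ "2*n"])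
  also have "\<dots> = ?J * P"
    using P by (simp add: symplectic_J_square)
  finally have "?R * ?J * D * transpose_mat P = ?J * P * D * transpose_mat P"
    by simp
  then show "?J * (P * D * transpose_mat P) = ?R * (?J * D) * transpose_mat P"
    using P D by (simp add: assoc_mult_mat[of _ "2*n" "2*n" _ "2*n" _ "2*n"]
        square_mult_carrier[of _ "2*n"])
  show "?J * (P * D * transpose_mat P) \<in> carrier_mat (2*n) (2*n)"
    "transpose_mat P \<in> carrier_mat (2*n) (2*n)" "?J * D \<in> carrier_mat (2*n) (2*n)"
    using P D by (auto simp: square_mult_carrier)
qed (use Sp_transpose_inverse[OF assms(1)] in auto)

text \<open>The left-hand side mentions only \<open>G\<close>, so the multiset on the right is the
  same for every symplectic factorization of \<open>G\<close>.\<close>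

lemma proots_char_poly_symplectic_J_square:
  assumes "P \<in> Sp n" and G: "G = P * double_diag n l * transpose_mat P"
  shows "proots (char_poly ((symplectic_J n * G) ^\<^sub>m 2)) =
    mset (map (\<lambda>i. - (l i)\<^sup>2) [0..<n]) + mset (map (\<lambda>i. - (l i)\<^sup>2) [0..<n])"
proof -
  have "similar_mat ((symplectic_J n * G) ^\<^sub>m 2) ((symplectic_J n * double_diag n l) ^\<^sub>m 2)"
    unfolding G similar_mat_def
    using similar_mat_wit_pow[OF similar_symplectic_J_mult[OF assms(1) double_diag_carrier]]
    by blast
  moreover have "(symplectic_J n * double_diag n l) ^\<^sub>m 2 = double_diag n (\<lambda>i. - (l i)\<^sup>2)"
    using symplectic_J_double_diag_square[of n l] by (simp add: numeral_2_eq_2)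
  ultimately show ?thesis
    by (simp only: char_poly_similar proots_char_poly_double_diag)
qed

lemma double_diag_mult_unit_vec:
  assumes "i < n"
  shows "double_diag n l *\<^sub>v unit_vec (2*n) i = l i \<cdot>\<^sub>v unit_vec (2*n) i"
  using assms by (intro eq_vecI) (auto simp: double_diag_def mat_diag_def)

lemma sym_pos_def_double_diag_pos:
  assumes "sym_pos_def (2*n) G" and "P \<in> Sp n"
    and G: "G = P * double_diag n l * transpose_mat P" and i: "i < n"
  shows "0 < l i"
proof -
  \<comment> \<open>The test vector is the preimage of the \<open>i\<close>-th unit vector under
    \<open>P^T\<close>; the quadratic form of \<open>G\<close> at \<open>v\<close> is then the
    diagonal entry \<open>l i\<close>.\<close>
  define v where "v = (- (symplectic_J n * P * symplectic_J n)) *\<^sub>v unit_vec (2*n) i"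
  note P = Sp_dim[OF assms(2)]
  note R = Sp_transpose_inverse[OF assms(2)]
  have v: "v \<in> carrier_vec (2*n)"
    unfolding v_def by (rule mult_mat_vec_carrier[OF R(1)]) simp
  have Pv: "transpose_mat P *\<^sub>v v = unit_vec (2*n) i"
    unfolding v_def using P R
    by (subst assoc_mult_mat_vec[symmetric, of _ "2*n" "2*n" _ "2*n"]) auto
  have "transpose_mat P *\<^sub>v 0\<^sub>v (2*n) = 0\<^sub>v (2*n)"
    using P by (intro eq_vecI) auto
  moreover have "unit_vec (2*n) i \<noteq> (0\<^sub>v (2*n) :: real vec)"
    using i by (simp add: unit_vec_nonzero)
  ultimately have "v \<noteq> 0\<^sub>v (2*n)"
    using Pv by auto
  then have "0 < v \<bullet> (G *\<^sub>v v)"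
    using assms(1) v by (auto simp: sym_pos_def_def)
  also have "G *\<^sub>v v = P *\<^sub>v (double_diag n l *\<^sub>v (transpose_mat P *\<^sub>v v))"
    unfolding G using P v
    by (simp add: assoc_mult_mat_vec[of _ "2*n" "2*n" _ "2*n"])
  also have "v \<bullet> \<dots> = (transpose_mat P *\<^sub>v v) \<bullet> (double_diag n l *\<^sub>v (transpose_mat P *\<^sub>v v))"
    using P v by (subst transpose_vec_mult_scalar[OF P(1) _ v])
      (auto intro!: mult_mat_vec_carrier[OF double_diag_carrier])
  also have "\<dots> = l i"
    using i by (simp add: Pv double_diag_mult_unit_vec)
  finally show ?thesis .
qed

lemma symplectic_diagonalization_unique:
  assumes "sym_pos_def (2*n) G"
    and "P \<in> Sp n" "G = P * double_diag n l * transpose_mat P"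
    and "Q \<in> Sp n" "G = Q * double_diag n m * transpose_mat Q"
  shows "\<exists>p. p permutes {..<n} \<and> (\<forall>i<n. l i = m (p i))"
proof -
  let ?sq = "\<lambda>l :: nat \<Rightarrow> real. mset (map (\<lambda>i. - (l i)\<^sup>2) [0..<n])"
  \<comment> \<open>Positivity excludes sign ambiguity: \<open>sqrt (- x)\<close> recovers
    \<open>k i\<close> from \<open>- (k i)^2\<close>.\<close>
  have sqrt_sq: "image_mset (\<lambda>x. sqrt (- x)) (?sq k) = mset (map k [0..<n])"
    if "\<And>i. i < n \<Longrightarrow> 0 < k i" for k
    using that by (auto simp: less_imp_le multiset.map_comp o_def intro!: image_mset_cong)
  have "?sq l + ?sq l = ?sq m + ?sq m"
    using proots_char_poly_symplectic_J_square[OF assms(2,3)]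
      proots_char_poly_symplectic_J_square[OF assms(4,5)] by simp
  \<comment> \<open>Every multiplicity occurs doubled on both sides and can be halved.\<close>
  then have "?sq l = ?sq m"
    by (auto simp: multiset_eq_iff simp flip: mult_2)
  then have "mset (map l [0..<n]) = mset (map m [0..<n])"
    using sqrt_sq[of l] sqrt_sq[of m] sym_pos_def_double_diag_pos[OF assms(1,2,3)]
      sym_pos_def_double_diag_pos[OF assms(1,4,5)] by simp
  then obtain p where p: "p permutes {..<length (map m [0..<n])}"
      "permute_list p (map m [0..<n]) = map l [0..<n]"
    by (rule mset_eq_permutation)
  have "l i = m (p i)" if "i < n" for i
  proof -
    have "p i < n"
      using permutes_in_image[OF p(1), of i] that by simp
    then show ?thesis
      using permute_list_nth[OF p(1), of i] that p(2) by simp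
  qed
  then show ?thesis
    using p(1) by auto
qed

theorem mainTheorem3:
  fixes n :: nat and M V G S :: "real mat" and eps lam :: "nat \<Rightarrow> real"
  assumes "M \<in> Sp n"
    and "diagonalizable (map_mat complex_of_real M)"
    and "card (spectrum (map_mat complex_of_real M)) = 2 * n"
    and "\<forall>z \<in> spectrum (map_mat complex_of_real M). cmod z = 1"
    and "linear_normal_form_map n M V"
    and "sym_pos_def (2*n) G"
    and "linearly_matched M G"
    and "G = V * double_diag n eps * transpose_mat V"
    and "S \<in> Sp n"
    and "G = transpose_mat S * double_diag n lam * S"
  shows "\<exists>p. p permutes {..<n} \<and> (\<forall>i<n. lam i = eps (p i))"
proof -
  have "V \<in> Sp n"
    using assms(5) by (simp add: linear_normal_form_map_def)
  \<comment> \<open>The factor \<open>S^T\<close> carries the symplectic spectrum and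
    \<open>V\<close> the emittances; \<open>S\<close> itself appears as the transpose of
    \<open>S^T\<close>.\<close>
  with assms Sp_transpose[OF assms(9)] show ?thesis
    using symplectic_diagonalization_unique[of n G "transpose_mat S" lam V eps] by simp
qed

end
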